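(* Let $r>0$ and let $V_r:=\{v\in\mathcal{K} : v(x)=0 \text{ for all } \|x\|_2\ge r\}$, a closed subspace of $\mathcal{K}$. If there are bump functions of support radius $r$ (i.e. $\mathcal{B}_r\neq\emptyset$), then the unique norm-minimal bump function $b_r^*$ on $B_r(0)$ has the form $$b_r^*=g_r/g_r(0),$$ where $g_r$ is the orthogonal projection of $K(0,\cdot)$ onto $V_r$ in $\mathcal{K}$. The squared norm of the solution is $$\|b_r^*\|_K^2=\frac{\|g_r\|_K^2}{g_r^2(0)}=\frac{1}{g_r(0)}.$$
   Context: $K$ is a continuous symmetric positive definite translation-invariant real-valued kernel on $\mathbb{R}^d\times\mathbb{R}^d$, and $\mathcal{K}$ is its native space, i.e. the Hilbert space of functions on $\mathbb{R}^d$ with inner product $(\cdot,\cdot)_K$ and norm $\|\cdot\|_K$ for which $K$ is the reproducing kernel: $f(x)=(f,K(x,\cdot))_K$ for all $f\in\mathcal{K}$, $x\in\mathbb{R}^d$. The set of bump functions of support radius $r$ is $\mathcal{B}_r:=\{b\in\mathcal{K} : b(0)=1,\ b(y)=0 \text{ for all } \|y\|_2\ge r\}$, and a bump function $b_r^*\in\mathcal{B}_r$ is norm-minimal if $\|b_r^*\|_K=\inf\{\|b\|_K : b\in\mathcal{B}_r\}$. $B_r(0)$ is the ball of radius $r$ around the origin. *)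

theory Defs
  imports "HOL-Analysis.Analysis" "HOL-Library.Function_Algebras"
begin

definition fun_scale :: "real \<Rightarrow> ('a \<Rightarrow> real) \<Rightarrow> 'a \<Rightarrow> real" where
  "fun_scale c f = (\<lambda>x. c * f x)"

global_interpretation fun_space: vector_space "fun_scale :: real \<Rightarrow> ('a \<Rightarrow> real) \<Rightarrow> 'a \<Rightarrow> real"
  by unfold_locales (auto simp: fun_scale_def fun_eq_iff algebra_simps)

definition symmetric_kernel :: "('a \<Rightarrow> 'a \<Rightarrow> real) \<Rightarrow> bool" where
  "symmetric_kernel K \<longleftrightarrow> (\<forall>x y. K x y = K y x)"

definition translation_invariant_kernel :: "('a::ab_group_add \<Rightarrow> 'a \<Rightarrow> real) \<Rightarrow> bool" where
  "translation_invariant_kernel K \<longleftrightarrow> (\<forall>x y z. K (x + z) (y + z) = K x y)"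

definition continuous_kernel :: "('a::topological_space \<Rightarrow> 'a \<Rightarrow> real) \<Rightarrow> bool" where
  "continuous_kernel K \<longleftrightarrow> continuous_on UNIV (\<lambda>(x, y). K x y)"

text \<open>Positive definiteness in the sense of kernel-based approximation: all kernel matrices
  \<open>(K x y)\<close> for \<open>x, y\<close> in a finite set of points are positive definite
  (not merely positive semidefinite).\<close>

definition positive_definite_kernel :: "('a \<Rightarrow> 'a \<Rightarrow> real) \<Rightarrow> bool" where
  "positive_definite_kernel K \<longleftrightarrow>
     (\<forall>X c. finite X \<longrightarrow> (\<exists>x\<in>X. c x \<noteq> 0) \<longrightarrow> (\<Sum>x\<in>X. \<Sum>y\<in>X. c x * c y * K x y) > 0)"

text \<open>Inner products are total functions of which only the values on the carrier \<open>H\<close> matter.\<close>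

locale inner_function_space =
  fixes H :: "('a \<Rightarrow> real) set" and ip :: "('a \<Rightarrow> real) \<Rightarrow> ('a \<Rightarrow> real) \<Rightarrow> real"
  assumes subspace_H: "fun_space.subspace H"
    and ip_commute: "\<lbrakk>f \<in> H; g \<in> H\<rbrakk> \<Longrightarrow> ip f g = ip g f"
    and ip_add_left: "\<lbrakk>f \<in> H; g \<in> H; h \<in> H\<rbrakk> \<Longrightarrow> ip (f + g) h = ip f h + ip g h"
    and ip_scale_left: "\<lbrakk>f \<in> H; g \<in> H\<rbrakk> \<Longrightarrow> ip (fun_scale c f) g = c * ip f g"
    and ip_pos: "\<lbrakk>f \<in> H; f \<noteq> 0\<rbrakk> \<Longrightarrow> ip f f > 0"

definition ip_norm :: "(('a \<Rightarrow> real) \<Rightarrow> ('a \<Rightarrow> real) \<Rightarrow> real) \<Rightarrow> ('a \<Rightarrow> real) \<Rightarrow> real" where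
  "ip_norm ip f = sqrt (ip f f)"

text \<open>The value outside the carrier is irrelevant; it is set to \<open>0\<close> because \<^locale>\<open>Metric_space\<close>
  requires nonnegativity and symmetry on the whole type.\<close>

definition ip_dist ::
  "('a \<Rightarrow> real) set \<Rightarrow> (('a \<Rightarrow> real) \<Rightarrow> ('a \<Rightarrow> real) \<Rightarrow> real) \<Rightarrow> ('a \<Rightarrow> real) \<Rightarrow> ('a \<Rightarrow> real) \<Rightarrow> real"
  where "ip_dist H ip f g = (if f \<in> H \<and> g \<in> H then ip_norm ip (f - g) else 0)"

context inner_function_space
begin

lemma ip_add_right: "\<lbrakk>f \<in> H; g \<in> H; h \<in> H\<rbrakk> \<Longrightarrow> ip h (f + g) = ip h f + ip h g"
  by (metis fun_space.subspace_add ip_add_left ip_commute subspace_H)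

lemma ip_scale_right: "\<lbrakk>f \<in> H; g \<in> H\<rbrakk> \<Longrightarrow> ip g (fun_scale c f) = c * ip g f"
  by (metis fun_space.subspace_scale ip_commute ip_scale_left subspace_H)

lemma ip_zero: "ip 0 0 = 0"
  using ip_scale_left[of 0 0 0] fun_space.subspace_0[OF subspace_H] by simp

lemma ip_nonneg: "f \<in> H \<Longrightarrow> ip f f \<ge> 0"
  using ip_pos ip_zero by (cases "f = 0") (auto simp: less_imp_le)

lemma ip_expand:
  assumes "f \<in> H" "g \<in> H"
  shows "ip (f + fun_scale c g) (f + fun_scale c g) = ip f f + 2 * c * ip f g + c\<^sup>2 * ip g g"
proof -
  have cg: "fun_scale c g \<in> H" using assms fun_space.subspace_scale subspace_H by blast
  then have "f + fun_scale c g \<in> H" using assms fun_space.subspace_add subspace_H by blast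
  then have "ip (f + fun_scale c g) (f + fun_scale c g)
      = ip f f + c * ip f g + (c * ip g f + c * (c * ip g g))"
    using assms cg by (simp add: ip_add_left ip_add_right ip_scale_left ip_scale_right algebra_simps)
  then show ?thesis using ip_commute[OF assms] by (simp add: power2_eq_square)
qed

lemma Cauchy_Schwarz:
  assumes "f \<in> H" "g \<in> H"
  shows "ip f g \<le> ip_norm ip f * ip_norm ip g"
proof (cases "g = 0")
  case True
  then have "ip f g = 0" using ip_scale_right[of 0 f 0] assms by simp
  then show ?thesis using assms by (simp add: ip_norm_def ip_nonneg)
next
  case False
  then have gg: "ip g g > 0" using assms ip_pos by blast
  define c where "c = - ip f g / ip g g"
  have "f + fun_scale c g \<in> H"
    using assms fun_space.subspace_add fun_space.subspace_scale subspace_H by blast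
  then have "0 \<le> ip f f + 2 * c * ip f g + c\<^sup>2 * ip g g"
    using ip_expand[OF assms] ip_nonneg by metis
  also have "\<dots> = ip f f - (ip f g)\<^sup>2 / ip g g"
    using gg by (simp add: c_def field_simps power2_eq_square)
  finally have "(ip f g)\<^sup>2 \<le> ip f f * ip g g" using gg by (simp add: field_simps)
  then show ?thesis unfolding ip_norm_def by (simp add: real_le_rsqrt flip: real_sqrt_mult)
qed

lemma ip_norm_triangle:
  assumes "f \<in> H" "g \<in> H"
  shows "ip_norm ip (f + g) \<le> ip_norm ip f + ip_norm ip g"
proof -
  have "ip (f + g) (f + g) = ip f f + 2 * ip f g + ip g g"
    using ip_expand[OF assms, of 1] by simp
  also have "\<dots> \<le> (ip_norm ip f + ip_norm ip g)\<^sup>2"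
    using Cauchy_Schwarz[OF assms] assms by (simp add: ip_norm_def power2_sum ip_nonneg)
  finally show ?thesis
    using assms by (subst ip_norm_def) (simp add: real_le_lsqrt ip_norm_def ip_nonneg)
qed

lemma Metric_space_ip_dist: "Metric_space H (ip_dist H ip)"
proof
  fix f g
  show "0 \<le> ip_dist H ip f g"
    using fun_space.subspace_diff[OF subspace_H] by (simp add: ip_dist_def ip_norm_def ip_nonneg)
  show "ip_dist H ip f g = ip_dist H ip g f"
  proof (cases "f \<in> H \<and> g \<in> H")
    case True
    then have "f - g \<in> H" using fun_space.subspace_diff[OF subspace_H] by blast
    moreover from this have "fun_scale (-1) (f - g) \<in> H"
      using fun_space.subspace_scale[OF subspace_H] by blast
    moreover have "g - f = fun_scale (-1) (f - g)" by (simp add: fun_scale_def fun_eq_iff)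
    ultimately have "ip (g - f) (g - f) = ip (f - g) (f - g)"
      by (simp add: ip_scale_left ip_scale_right del: fun_space.scale_minus_left)
    then show ?thesis by (simp add: ip_dist_def ip_norm_def)
  qed (auto simp: ip_dist_def)
next
  fix f g assume fg: "f \<in> H" "g \<in> H"
  then have "f - g \<in> H" using fun_space.subspace_diff[OF subspace_H] by blast
  then show "ip_dist H ip f g = 0 \<longleftrightarrow> f = g"
    using fg ip_pos[of "f - g"] ip_zero by (cases "f = g") (auto simp: ip_dist_def ip_norm_def)
next
  fix f g h assume fgh: "f \<in> H" "g \<in> H" "h \<in> H"
  then have "f - g \<in> H" "g - h \<in> H" using fun_space.subspace_diff[OF subspace_H] by blast+
  then show "ip_dist H ip f h \<le> ip_dist H ip f g + ip_dist H ip g h"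
    using fgh ip_norm_triangle[of "f - g" "g - h"] by (simp add: ip_dist_def)
qed

end

text \<open>The reproducing kernel determines \<open>H\<close> and, on \<open>H\<close>, the inner product \<open>ip\<close> uniquely.\<close>

locale native_space = inner_function_space H ip
  for K :: "'a \<Rightarrow> 'a \<Rightarrow> real" and H ip +
  assumes complete_H: "Metric_space.mcomplete H (ip_dist H ip)"
    and kernel_in_H: "K x \<in> H"
    and reproducing: "f \<in> H \<Longrightarrow> f x = ip f (K x)"

definition supported_functions ::
  "('a::real_normed_vector \<Rightarrow> real) set \<Rightarrow> real \<Rightarrow> ('a \<Rightarrow> real) set" where
  "supported_functions H r = {v \<in> H. \<forall>x. norm x \<ge> r \<longrightarrow> v x = 0}"

definition bump_functions ::
  "('a::real_normed_vector \<Rightarrow> real) set \<Rightarrow> real \<Rightarrow> ('a \<Rightarrow> real) set" where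
  "bump_functions H r = {b \<in> H. b 0 = 1 \<and> (\<forall>y. norm y \<ge> r \<longrightarrow> b y = 0)}"

definition norm_minimal_bump ::
  "('a::real_normed_vector \<Rightarrow> real) set \<Rightarrow> (('a \<Rightarrow> real) \<Rightarrow> ('a \<Rightarrow> real) \<Rightarrow> real)
    \<Rightarrow> real \<Rightarrow> ('a \<Rightarrow> real) \<Rightarrow> bool" where
  "norm_minimal_bump H ip r b \<longleftrightarrow>
     b \<in> bump_functions H r \<and> ip_norm ip b = Inf (ip_norm ip ` bump_functions H r)"

definition closed_subspace ::
  "('a \<Rightarrow> real) set \<Rightarrow> (('a \<Rightarrow> real) \<Rightarrow> ('a \<Rightarrow> real) \<Rightarrow> real) \<Rightarrow> ('a \<Rightarrow> real) set \<Rightarrow> bool" where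
  "closed_subspace H ip V \<longleftrightarrow>
     fun_space.subspace V \<and> closedin (Metric_space.mtopology H (ip_dist H ip)) V"

definition is_orthogonal_projection ::
  "(('a \<Rightarrow> real) \<Rightarrow> ('a \<Rightarrow> real) \<Rightarrow> real) \<Rightarrow> ('a \<Rightarrow> real) set \<Rightarrow> ('a \<Rightarrow> real) \<Rightarrow> ('a \<Rightarrow> real) \<Rightarrow> bool"
  where "is_orthogonal_projection ip V f g \<longleftrightarrow> g \<in> V \<and> (\<forall>v\<in>V. ip (f - g) v = 0)"

end

theory Submission
  imports Defs
begin

text \<open>The reproducing property makes point evaluations continuous, so \<open>V\<^sub>r\<close> is closed. Every
  \<open>b\<close> in \<open>V\<^sub>r\<close> satisfies \<open>b 0 = (b, K 0) = (b, g)\<close>, where \<open>g\<close> is the projection of \<open>K 0\<close>.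
  Hence \<open>g 0 = (g, g)\<close>, and the bump functions are the \<open>b\<close> in \<open>V\<^sub>r\<close> with \<open>(b, g) = 1\<close>: a
  hyperplane in \<open>V\<^sub>r\<close> whose element of least norm is the multiple of \<open>g\<close> that it contains.\<close>

section \<open>Inner products, estimates and limits\<close>

context inner_function_space
begin

lemma add_in_H: "\<lbrakk>f \<in> H; g \<in> H\<rbrakk> \<Longrightarrow> f + g \<in> H"
  using fun_space.subspace_add subspace_H by blast

lemma diff_in_H: "\<lbrakk>f \<in> H; g \<in> H\<rbrakk> \<Longrightarrow> f - g \<in> H"
  using fun_space.subspace_diff subspace_H by blast

lemma scale_in_H: "f \<in> H \<Longrightarrow> fun_scale c f \<in> H"
  using fun_space.subspace_scale subspace_H by blast

lemma ip_diff_left: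
  assumes "f \<in> H" "g \<in> H" "h \<in> H"
  shows "ip (f - g) h = ip f h - ip g h"
  using ip_add_left[OF diff_in_H[OF assms(1,2)] assms(2,3)] by simp

lemma ip_diff_right:
  assumes "f \<in> H" "g \<in> H" "h \<in> H"
  shows "ip h (f - g) = ip h f - ip h g"
  using ip_diff_left[OF assms] assms by (metis diff_in_H ip_commute)

lemma ip_zero_right: "f \<in> H \<Longrightarrow> ip f 0 = 0"
  using ip_diff_right[of f f f] by simp

lemma ip_norm_power2: "f \<in> H \<Longrightarrow> (ip_norm ip f)\<^sup>2 = ip f f"
  by (simp add: ip_norm_def ip_nonneg)

lemma ip_norm_minus_commute:
  assumes "f \<in> H" "g \<in> H"
  shows "ip_norm ip (f - g) = ip_norm ip (g - f)"
  using assms by (simp add: ip_norm_def ip_diff_left ip_diff_right diff_in_H)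

text \<open>\<open>Cauchy_Schwarz\<close> bounds only the signed value; applying it also to the
  negative of \<open>f\<close>, written \<open>0 - f\<close>, bounds the absolute value.\<close>

lemma abs_ip_le:
  assumes "f \<in> H" "g \<in> H"
  shows "\<bar>ip f g\<bar> \<le> ip_norm ip f * ip_norm ip g"
proof -
  have "ip (0 - f) g \<le> ip_norm ip (0 - f) * ip_norm ip g"
    using assms Cauchy_Schwarz diff_in_H fun_space.subspace_0[OF subspace_H] by blast
  moreover have "ip (0 - f) g = - ip f g"
    using assms ip_diff_left[of 0 f g] ip_zero_right[of g] ip_commute[of 0 g]
      fun_space.subspace_0[OF subspace_H] by simp
  moreover have "ip_norm ip (0 - f) = ip_norm ip f"
    using ip_norm_minus_commute[OF _ assms(1), of 0] fun_space.subspace_0[OF subspace_H] by simp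
  ultimately show ?thesis using Cauchy_Schwarz[OF assms] by simp
qed

lemma parallelogram_law:
  assumes "f \<in> H" "g \<in> H"
  shows "ip (f - g) (f - g) + ip (f + g) (f + g) = 2 * ip f f + 2 * ip g g"
  using assms
  by (simp add: ip_diff_left ip_diff_right ip_add_left ip_add_right add_in_H diff_in_H)

text \<open>By Cauchy-Schwarz, the error is at most the distance from \<open>s n\<close> to
  \<open>l\<close> times the norm of \<open>h\<close>.\<close>

lemma ip_tendsto:
  assumes lim: "limitin (Metric_space.mtopology H (ip_dist H ip)) s l sequentially"
    and s: "range s \<subseteq> H" and h: "h \<in> H"
  shows "(\<lambda>n. ip (s n) h) \<longlonglongrightarrow> ip l h"
proof -
  interpret M: Metric_space H "ip_dist H ip" by (rule Metric_space_ip_dist)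
  have l: "l \<in> H" and d: "(\<lambda>n. ip_dist H ip (s n) l) \<longlonglongrightarrow> 0"
    using lim by (auto simp: M.limitin_metric_dist_null)
  have bound: "norm (ip (s n) h - ip l h) \<le> ip_dist H ip (s n) l * ip_norm ip h" for n
  proof -
    \<comment> \<open>Membership matters: outside \<open>H\<close>, \<open>ip_dist\<close> takes the
      default value 0 and would not be the norm of the difference.\<close>
    have "s n \<in> H" using s by auto
    then show ?thesis
      using abs_ip_le[OF diff_in_H h, of "s n" l] l h by (simp add: ip_dist_def ip_diff_left)
  qed
  have "(\<lambda>n. ip (s n) h - ip l h) \<longlonglongrightarrow> 0"
    by (rule Lim_null_comparison[OF always_eventually tendsto_mult_left_zero[OF d]])
      (use bound in blast)
  then show ?thesis by (simp add: LIM_zero_iff)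
qed

text \<open>The quadratic polynomial in \<open>t\<close> is evaluated at its minimizer
  \<open>t = - ip u v / ip v v\<close>. If \<open>ip u u\<close> is close to the lower bound
  \<open>D\<close>, then \<open>u\<close> is almost orthogonal to \<open>v\<close>.\<close>

lemma ip_square_le_of_minimal:
  assumes u: "u \<in> H" and v: "v \<in> H"
    and min: "\<And>t. D \<le> ip (u + fun_scale t v) (u + fun_scale t v)"
  shows "(ip u v)\<^sup>2 \<le> (ip u u - D) * ip v v"
proof (cases "v = 0")
  case True
  then show ?thesis using u ip_zero ip_zero_right by simp
next
  case False
  then have vv: "ip v v > 0" using v ip_pos by blast
  have "D \<le> ip u u + 2 * (- ip u v / ip v v) * ip u v + (- ip u v / ip v v)\<^sup>2 * ip v v"
    using min ip_expand[OF u v] by metis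
  also have "\<dots> = ip u u - (ip u v)\<^sup>2 / ip v v"
    using vv by (simp add: field_simps power2_eq_square)
  finally show ?thesis using vv by (simp add: field_simps)
qed

section \<open>Orthogonal projection onto a closed subspace\<close>

lemma closed_subspace_subset: "closed_subspace H ip V \<Longrightarrow> V \<subseteq> H"
  using closedin_subset Metric_space.topspace_mtopology[OF Metric_space_ip_dist]
  unfolding closed_subspace_def by metis

text \<open>A sequence in \<open>V\<close> that minimizes the squared distance to \<open>f\<close>
  is Cauchy by the parallelogram law, and its limit stays in the closed set \<open>V\<close>. The
  residuals \<open>f - s n\<close> are almost orthogonal to \<open>V\<close>, and this passes to the
  limit as exact orthogonality.\<close>

lemma orthogonal_projection_exists:
  assumes complete: "Metric_space.mcomplete H (ip_dist H ip)"
    and V: "closed_subspace H ip V" and f: "f \<in> H"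
  shows "\<exists>g. is_orthogonal_projection ip V f g"
proof -
  interpret M: Metric_space H "ip_dist H ip" by (rule Metric_space_ip_dist)
  have sub: "fun_space.subspace V" and closed: "closedin M.mtopology V"
    using V by (auto simp: closed_subspace_def)
  have VH: "v \<in> H" if "v \<in> V" for v using closed_subspace_subset[OF V] that by blast
  let ?q = "\<lambda>v. ip (f - v) (f - v)"
  define D where "D = Inf (?q ` V)"
  have nonempty: "V \<noteq> {}" using fun_space.subspace_0[OF sub] by blast
  have "bdd_below (?q ` V)" using f VH by (auto intro!: bdd_belowI2[of _ 0] ip_nonneg diff_in_H)
  then have D_le: "D \<le> ?q v" if "v \<in> V" for v
    using that unfolding D_def by (rule cINF_lower)
  have "\<exists>v\<in>V. ?q v < D + inverse (real (Suc n))" for n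
    using cInf_lessD[of "?q ` V" "D + inverse (real (Suc n))"] nonempty by (auto simp: D_def)
  then obtain s where sV: "\<And>n. s n \<in> V"
    and s_less: "\<And>n. ?q (s n) < D + inverse (real (Suc n))" by metis
  have sH: "s n \<in> H" for n using sV VH by blast
  have gap: "ip (s m - s n) (s m - s n) \<le> 2 * inverse (real (Suc m)) + 2 * inverse (real (Suc n))"
    for m n
  proof -
    \<comment> \<open>The sum of the residuals of \<open>s m\<close> and \<open>s n\<close> is twice
      the residual of their midpoint. The midpoint lies in \<open>V\<close>, so the sum has squared
      norm at least \<open>4 * D\<close>, and the parallelogram law leaves little room for the
      difference.\<close>
    let ?mid = "fun_scale (1/2) (s m + s n)"
    have mid: "?mid \<in> V" using sV sub fun_space.subspace_add fun_space.subspace_scale by blast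
    have "(f - s n) + (f - s m) = fun_scale 2 (f - ?mid)"
      by (simp add: fun_eq_iff fun_scale_def algebra_simps)
    then have "ip ((f - s n) + (f - s m)) ((f - s n) + (f - s m)) = 4 * ?q ?mid"
      using f mid VH by (simp add: ip_scale_left ip_scale_right diff_in_H scale_in_H)
    moreover have "(f - s n) - (f - s m) = s m - s n" by simp
    ultimately have "ip (s m - s n) (s m - s n) + 4 * ?q ?mid = 2 * ?q (s n) + 2 * ?q (s m)"
      using parallelogram_law[of "f - s n" "f - s m"] f sH by (simp add: diff_in_H)
    then show ?thesis using D_le[OF mid] s_less[of m] s_less[of n] by linarith
  qed
  have "M.MCauchy s"
    unfolding M.MCauchy_def
  proof (intro conjI allI impI)
    show "range s \<subseteq> H" using sH by blast
    fix e :: real assume e: "e > 0"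
    then have "e\<^sup>2 / 4 > 0" by simp
    \<comment> \<open>From index \<open>N\<close> on, \<open>gap\<close> is at most four times
      \<open>inverse (real (Suc N))\<close>.\<close>
    then obtain N where N: "inverse (real (Suc N)) < e\<^sup>2 / 4" using reals_Archimedean by blast
    have "ip_dist H ip (s m) (s n) < e" if "N \<le> m" "N \<le> n" for m n
    proof -
      have "inverse (real (Suc m)) \<le> inverse (real (Suc N))"
        "inverse (real (Suc n)) \<le> inverse (real (Suc N))"
        using that by (auto intro!: le_imp_inverse_le)
      then have "ip (s m - s n) (s m - s n) < e\<^sup>2" using gap[of m n] N by linarith
      then have "ip_norm ip (s m - s n) < e"
        using e by (simp add: ip_norm_def real_less_lsqrt)
      then show ?thesis using sH by (simp add: ip_dist_def)
    qed
    then show "\<exists>N. \<forall>n n'. N \<le> n \<longrightarrow> N \<le> n' \<longrightarrow> ip_dist H ip (s n) (s n') < e" by blast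
  qed
  then obtain g where lim: "limitin M.mtopology s g sequentially"
    using complete unfolding M.mcomplete_def by blast
  have g: "g \<in> V"
    by (rule limitin_closedin[OF lim closed]) (use sV in auto)
  have "ip (f - g) v = 0" if v: "v \<in> V" for v
  proof -
    have lim_ip: "(\<lambda>n. ip (f - s n) v) \<longlonglongrightarrow> ip (f - g) v"
    proof -
      have "(\<lambda>n. ip f v - ip (s n) v) \<longlonglongrightarrow> ip f v - ip g v"
        by (intro tendsto_diff tendsto_const ip_tendsto[OF lim]) (use sH VH v in auto)
      then show ?thesis using f sH VH g v by (simp add: ip_diff_left)
    qed
    have "(ip (f - s n) v)\<^sup>2 \<le> inverse (real (Suc n)) * ip v v" for n
    proof -
      \<comment> \<open>Moving the residual along \<open>v\<close> gives the residual of another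
        element of \<open>V\<close>, so \<open>D\<close> is still a lower bound.\<close>
      have "D \<le> ip (f - s n + fun_scale t v) (f - s n + fun_scale t v)" for t
      proof -
        have "s n - fun_scale t v \<in> V"
          using sV v sub fun_space.subspace_diff fun_space.subspace_scale by blast
        then show ?thesis using D_le[of "s n - fun_scale t v"] by (simp add: algebra_simps)
      qed
      then have "(ip (f - s n) v)\<^sup>2 \<le> (?q (s n) - D) * ip v v"
        by (intro ip_square_le_of_minimal) (use f sH VH v diff_in_H in auto)
      also have "\<dots> \<le> inverse (real (Suc n)) * ip v v"
        using s_less[of n] ip_nonneg[OF VH[OF v]] by (intro mult_right_mono) auto
      finally show ?thesis .
    qed
    then have "(ip (f - g) v)\<^sup>2 \<le> 0 * ip v v"
      by (intro tendsto_le[OF sequentially_bot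
            tendsto_mult_right[OF LIMSEQ_inverse_real_of_nat] tendsto_power[OF lim_ip]])
        (auto intro: always_eventually)
    then show ?thesis by simp
  qed
  then show ?thesis using g unfolding is_orthogonal_projection_def by blast
qed

text \<open>The difference \<open>g - h\<close> lies in \<open>V\<close>, so both residuals are
  orthogonal to it; hence it is orthogonal to itself.\<close>

lemma orthogonal_projection_unique:
  assumes V: "fun_space.subspace V" "V \<subseteq> H" and f: "f \<in> H"
    and g: "is_orthogonal_projection ip V f g" and h: "is_orthogonal_projection ip V f h"
  shows "g = h"
proof -
  have mem: "g \<in> V" "h \<in> V" "g - h \<in> V" and H: "g \<in> H" "h \<in> H" "g - h \<in> H"
    using g h V fun_space.subspace_diff by (auto simp: is_orthogonal_projection_def)
  have "ip (f - g) (g - h) = 0" "ip (f - h) (g - h) = 0"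
    using g h mem by (auto simp: is_orthogonal_projection_def)
  then have "ip (g - h) (g - h) = 0" using f H by (simp add: ip_diff_left)
  then show ?thesis using ip_pos[OF H(3)] by fastforce
qed

end

section \<open>Point evaluations and functions normalized at a point\<close>

context native_space
begin

text \<open>Evaluation at \<open>x\<close> is the inner product with \<open>K x\<close>, hence
  continuous, so zeros survive limits in \<open>H\<close>.\<close>

lemma closed_subspace_vanishing: "closed_subspace H ip {v \<in> H. \<forall>x\<in>Z. v x = 0}" (is "closed_subspace _ _ ?V")
proof -
  interpret M: Metric_space H "ip_dist H ip" by (rule Metric_space_ip_dist)
  have "fun_space.subspace ?V"
    using subspace_H by (auto simp: fun_space.subspace_def fun_scale_def)
  moreover have "closedin M.mtopology ?V"
    unfolding M.metric_closedin_iff_sequentially_closed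
  proof (intro conjI allI impI; (elim conjE)?)
    fix s l assume s: "range s \<subseteq> ?V" and lim: "limitin M.mtopology s l sequentially"
    have l: "l \<in> H" using lim M.limitin_mspace by blast
    have "l x = 0" if x: "x \<in> Z" for x
    proof -
      have "ip (s n) (K x) = 0" for n
        using s x reproducing[of "s n" x] by (auto simp: image_subset_iff)
      moreover have "(\<lambda>n. ip (s n) (K x)) \<longlonglongrightarrow> ip l (K x)"
        by (rule ip_tendsto[OF lim _ kernel_in_H]) (use s in auto)
      ultimately show ?thesis using reproducing[OF l] by (simp add: LIMSEQ_const_iff)
    qed
    then show "l \<in> ?V" using l by blast
  qed auto
  ultimately show ?thesis by (simp add: closed_subspace_def)
qed

text \<open>Since \<open>K p - g\<close> is orthogonal to \<open>V\<close>, replacing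
  \<open>K p\<close> by \<open>g\<close> does not change inner products with elements of
  \<open>V\<close>: \<open>g\<close> represents evaluation at \<open>p\<close> on
  \<open>V\<close>.\<close>

lemma ip_projection_kernel:
  assumes "V \<subseteq> H" "is_orthogonal_projection ip V (K p) g" "v \<in> V"
  shows "ip v g = v p"
proof -
  have "g \<in> H" "v \<in> H" "ip (K p - g) v = 0"
    using assms by (auto simp: is_orthogonal_projection_def)
  then show ?thesis
    using reproducing[of v p] kernel_in_H[of p] by (simp add: ip_diff_left ip_commute)
qed

text \<open>The function \<open>b\<close> forces \<open>ip b g = 1\<close>, so \<open>g\<close> is
  nonzero, and \<open>g p\<close> equals \<open>ip g g\<close>.\<close>

lemma projection_kernel_pos:
  assumes V: "V \<subseteq> H" and g: "is_orthogonal_projection ip V (K p) g"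
    and b: "b \<in> V" "b p = 1"
  shows "g p > 0"
proof -
  have gV: "g \<in> V" using g by (simp add: is_orthogonal_projection_def)
  have "ip b g = 1" using ip_projection_kernel[OF V g b(1)] b(2) by simp
  then have "g \<noteq> 0" using ip_zero_right V b(1) by force
  then show ?thesis using ip_pos[of g] ip_projection_kernel[OF V g gV] V gV by auto
qed

text \<open>This is Pythagoras: \<open>ip b c\<close> and \<open>ip c c\<close> both equal
  \<open>1 / g p\<close>, so \<open>b - c\<close> is orthogonal to \<open>c\<close>.\<close>

lemma ip_normalized_bump:
  assumes V: "V \<subseteq> H" and g: "is_orthogonal_projection ip V (K p) g"
    and b: "b \<in> V" "b p = 1"
  defines "c \<equiv> fun_scale (1 / g p) g"
  shows "ip b b = 1 / g p + ip (b - c) (b - c)" "ip c c = 1 / g p"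
proof -
  have gV: "g \<in> V" using g by (simp add: is_orthogonal_projection_def)
  then have H: "b \<in> H" "g \<in> H" "c \<in> H" using V b scale_in_H by (auto simp: c_def)
  have pos: "g p > 0" by (rule projection_kernel_pos[OF V g b])
  have "ip g g = g p" "ip b g = 1" using ip_projection_kernel[OF V g] gV b by auto
  then have "ip b c = 1 / g p" and cc: "ip c c = 1 / g p"
    using H pos scale_in_H by (simp_all add: c_def ip_scale_left ip_scale_right)
  then show "ip b b = 1 / g p + ip (b - c) (b - c)" "ip c c = 1 / g p"
    using H ip_commute[of b c] by (simp_all add: ip_diff_left ip_diff_right diff_in_H)
qed

text \<open>By \<open>ip_normalized_bump\<close>, the squared norm of a competitor exceeds that of
  \<open>?c\<close> by exactly its squared distance from \<open>?c\<close>. So \<open>?c\<close>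
  attains the infimum, and equality of norms forces equality of functions.\<close>

lemma norm_minimal_iff_normalized_projection:
  assumes V: "fun_space.subspace V" "V \<subseteq> H" and g: "is_orthogonal_projection ip V (K p) g"
    and nonempty: "{b \<in> V. b p = 1} \<noteq> {}"
  shows "b \<in> {b \<in> V. b p = 1} \<and> ip_norm ip b = Inf (ip_norm ip ` {b \<in> V. b p = 1})
    \<longleftrightarrow> b = fun_scale (1 / g p) g"
    (is "b \<in> ?B \<and> _ = Inf ?N \<longleftrightarrow> b = ?c")
proof -
  obtain b0 where b0: "b0 \<in> V" "b0 p = 1" using nonempty by blast
  have pos: "g p > 0" by (rule projection_kernel_pos[OF V(2) g b0])
  have gV: "g \<in> V" using g by (simp add: is_orthogonal_projection_def)
  then have "?c \<in> V" by (rule fun_space.subspace_scale[OF V(1)])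
  moreover have "?c p = 1" using pos by (simp add: fun_scale_def)
  ultimately have c: "?c \<in> ?B" by blast
  have H: "b - ?c \<in> H" if "b \<in> V" for b using that c V(2) diff_in_H by blast
  have min: "ip_norm ip ?c \<le> ip_norm ip b" if "b \<in> ?B" for b
    using that ip_normalized_bump[OF V(2) g, of b] ip_nonneg[OF H, of b] by (simp add: ip_norm_def)
  have Inf: "Inf ?N = ip_norm ip ?c"
    by (rule cInf_eq_minimum) (use c min in auto)
  have "b = ?c" if b: "b \<in> ?B" and eq: "ip_norm ip b = ip_norm ip ?c"
  proof -
    have "ip (b - ?c) (b - ?c) = 0"
      using b eq ip_normalized_bump[OF V(2) g, of b] by (simp add: ip_norm_def)
    then show ?thesis using ip_pos[OF H, of b] b by fastforce
  qed
  then show ?thesis using Inf c by auto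
qed

end

theorem theorem9:
  fixes K :: "real ^ 'd \<Rightarrow> real ^ 'd \<Rightarrow> real"
    and H :: "(real ^ 'd \<Rightarrow> real) set"
    and ip :: "(real ^ 'd \<Rightarrow> real) \<Rightarrow> (real ^ 'd \<Rightarrow> real) \<Rightarrow> real"
    and r :: real
  assumes "continuous_kernel K"
    and "symmetric_kernel K"
    and "positive_definite_kernel K"
    and "translation_invariant_kernel K"
    and "native_space K H ip"
    and "r > 0"
  shows "closed_subspace H ip (supported_functions H r) \<and>
    (\<exists>!g. is_orthogonal_projection ip (supported_functions H r) (K 0) g) \<and>
    (bump_functions H r \<noteq> {} \<longrightarrow>
      (\<exists>!b. norm_minimal_bump H ip r b) \<and>
      (\<forall>g b. is_orthogonal_projection ip (supported_functions H r) (K 0) g \<longrightarrow>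
             norm_minimal_bump H ip r b \<longrightarrow>
        g 0 \<noteq> 0 \<and>
        b = (\<lambda>x. g x / g 0) \<and>
        (ip_norm ip b)\<^sup>2 = (ip_norm ip g)\<^sup>2 / (g 0)\<^sup>2 \<and>
        (ip_norm ip g)\<^sup>2 / (g 0)\<^sup>2 = 1 / g 0))"
proof -
  interpret native_space K H ip by fact
  define V where "V = supported_functions H r"
  have closed: "closed_subspace H ip V"
    using closed_subspace_vanishing[of "{x. r \<le> norm x}"]
    by (simp add: V_def supported_functions_def)
  have sub: "fun_space.subspace V" and VH: "V \<subseteq> H"
    using closed closed_subspace_subset by (auto simp: closed_subspace_def)
  have bump: "bump_functions H r = {b \<in> V. b 0 = 1}"
    by (auto simp: V_def bump_functions_def supported_functions_def)
  have ex1: "\<exists>!g. is_orthogonal_projection ip V (K 0) g"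
    using orthogonal_projection_exists[OF complete_H closed kernel_in_H]
      orthogonal_projection_unique[OF sub VH kernel_in_H] by blast
  have minimal_iff: "norm_minimal_bump H ip r b \<longleftrightarrow> b = fun_scale (1 / g 0) g"
    if "is_orthogonal_projection ip V (K 0) g" "bump_functions H r \<noteq> {}" for g b
    using norm_minimal_iff_normalized_projection[OF sub VH that(1)] that(2)
    by (simp add: norm_minimal_bump_def bump)
  have formula: "g 0 \<noteq> 0 \<and> b = (\<lambda>x. g x / g 0) \<and>
      (ip_norm ip b)\<^sup>2 = (ip_norm ip g)\<^sup>2 / (g 0)\<^sup>2 \<and> (ip_norm ip g)\<^sup>2 / (g 0)\<^sup>2 = 1 / g 0"
    if g: "is_orthogonal_projection ip V (K 0) g" and b: "norm_minimal_bump H ip r b" for g b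
  proof -
    \<comment> \<open>The minimal \<open>b\<close> is itself a bump function; it witnesses the
      nonemptiness that \<open>minimal_iff\<close> demands and makes \<open>g 0\<close>
      positive.\<close>
    have bV: "b \<in> V" "b 0 = 1" using b by (auto simp: norm_minimal_bump_def bump)
    have pos: "g 0 > 0" by (rule projection_kernel_pos[OF VH g bV])
    have gV: "g \<in> V" using g by (simp add: is_orthogonal_projection_def)
    have beq: "b = fun_scale (1 / g 0) g" using minimal_iff[OF g] b bV bump by auto
    have "(ip_norm ip b)\<^sup>2 = 1 / g 0"
      using ip_normalized_bump(2)[OF VH g bV] beq bV(1) VH ip_norm_power2 by auto
    moreover have "(ip_norm ip g)\<^sup>2 = g 0"
      using ip_projection_kernel[OF VH g gV] gV VH ip_norm_power2 by auto
    ultimately show ?thesis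
      using pos beq by (simp add: fun_scale_def power2_eq_square)
  qed
  \<comment> \<open>For the projection \<open>g\<close> given by \<open>ex1\<close>,
    \<open>minimal_iff\<close> identifies the minimizers with a single function.\<close>
  have "\<exists>!b. norm_minimal_bump H ip r b" if "bump_functions H r \<noteq> {}"
    using ex1 minimal_iff[OF _ that] by auto
  then show ?thesis
    unfolding V_def[symmetric] using closed ex1 formula by (intro conjI impI allI) blast+
qed

end
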